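(* Let $k\ge 2$ and $G=(V,E)$ be an arbitrary graph. Then \[ \sum_{n_1,\ldots,n_k=1}^{\infty} \frac{\delta_G(n_1,\ldots,n_k)}{n_1^{s_1}\cdots n_k^{s_k}} =\zeta(s_1)\cdots \zeta(s_k)\, D'_G(s_1,\ldots,s_k), \] where \begin{align*} D'_G(s_1,\ldots,s_k) & = \prod_p \Bigg( \sum_{\substack{L\subseteq J\\ L \text{ independent}}} \prod_{\ell \in L} \frac1{p^{s_{\ell}}} \prod_{i\in (J\setminus L) \cup (N(L)\setminus J)} \left(1-\frac1{p^{s_i}}\right)\Bigg) \\ & = \prod_p \Bigg(1 - \sum_{\{i,j\}\in E} \frac1{p^{s_i+s_j}} + \sum_{j=3}^{|I|} \sum_{\substack{i_1,\ldots,i_j\in I\\ i_1<\cdots <i_j}} \frac{c(i_1,\ldots,i_j)}{p^{s_{i_1}+\cdots +s_{i_j}}}\Bigg), \end{align*} where $c(i_1,\ldots,i_j)$ are some integers, depending on $i_1,\ldots,i_j$, but not on $p$. Furthermore, $D'_G(s_1,\ldots,s_k)$ with $s_1,\ldots,s_k\in\mathbb{C}$ is absolutely convergent provided that $\Re (s_{i_1}+\cdots +s_{i_j})>1$ for every $i_1,\ldots,i_j\in I$ with $i_1< \cdots < i_j$, $2\le j\le |I|$.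
   Context: Let $V=\{1,\ldots,k\}$ and $E\subseteq\{\{i,j\}:1\le i<j\le k\}$, giving the simple graph $G=(V,E)$. $\delta_G(n_1,\ldots,n_k)=1$ if $\gcd(n_i,n_j)=1$ for every $\{i,j\}\in E$ and $0$ otherwise. $I$ is the set of non-isolated vertices of $G$; $J$ is a (minimum) vertex cover of $G$, i.e. a set of vertices containing at least one endpoint of every edge. The sum over $L$ runs over the independent subsets $L$ of $J$ (no two vertices of $L$ adjacent in $G$). $N(j)$ denotes the neighbourhood of a vertex $j$, and $N(L)=\bigcup_{j\in L}N(j)$. $\zeta$ is the Riemann zeta function; products over $p$ are over primes. *)

theory Defs
  imports "HOL-Analysis.Analysis" "HOL-Computational_Algebra.Primes"
begin

text \<open>
  A simple graph on \<open>{1..k}\<close> is given by its set of edges, each edge being a two-element set.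
\<close>

definition simple_graph :: "nat \<Rightarrow> nat set set \<Rightarrow> bool" where
  "simple_graph k E \<longleftrightarrow> E \<subseteq> {{i, j} |i j. 1 \<le> i \<and> i < j \<and> j \<le> k}"

definition non_isolated :: "nat \<Rightarrow> nat set set \<Rightarrow> nat set" where
  "non_isolated k E = {i \<in> {1..k}. \<exists>j. {i, j} \<in> E}"

definition vertex_cover :: "nat \<Rightarrow> nat set set \<Rightarrow> nat set \<Rightarrow> bool" where
  "vertex_cover k E J \<longleftrightarrow> J \<subseteq> {1..k} \<and> (\<forall>e\<in>E. e \<inter> J \<noteq> {})"

definition independent_set :: "nat set set \<Rightarrow> nat set \<Rightarrow> bool" where
  "independent_set E L \<longleftrightarrow> (\<forall>i\<in>L. \<forall>j\<in>L. {i, j} \<notin> E)"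

definition nbhd :: "nat set set \<Rightarrow> nat \<Rightarrow> nat set" where
  "nbhd E j = {i. {i, j} \<in> E}"

definition nbhd_set :: "nat set set \<Rightarrow> nat set \<Rightarrow> nat set" where
  "nbhd_set E L = (\<Union>j\<in>L. nbhd E j)"

definition delta :: "nat set set \<Rightarrow> (nat \<Rightarrow> nat) \<Rightarrow> complex" where
  "delta E n = (if \<forall>i j. {i, j} \<in> E \<longrightarrow> gcd (n i) (n j) = 1 then 1 else 0)"

text \<open>
  The Riemann zeta function by its Dirichlet series; meaningful only for \<open>Re s > 1\<close>.
\<close>

definition zeta :: "complex \<Rightarrow> complex" where
  "zeta s = (\<Sum>n. 1 / of_nat (Suc n) powr s)"

text \<open>
  Infinite products over the primes, as products over the natural numbers in which
  every non-prime index contributes the factor 1.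
\<close>

definition euler_prod :: "(nat \<Rightarrow> complex) \<Rightarrow> complex" where
  "euler_prod f = (\<Prod>p. if prime p then f p else 1)"

definition abs_convergent_euler_prod :: "(nat \<Rightarrow> complex) \<Rightarrow> bool" where
  "abs_convergent_euler_prod f \<longleftrightarrow> abs_convergent_prod (\<lambda>p. if prime p then f p else 1)"

definition cover_factor ::
    "nat set set \<Rightarrow> nat set \<Rightarrow> (nat \<Rightarrow> complex) \<Rightarrow> nat \<Rightarrow> complex" where
  "cover_factor E J s p =
     (\<Sum>L | L \<subseteq> J \<and> independent_set E L.
        (\<Prod>l\<in>L. 1 / of_nat p powr s l) *
        (\<Prod>i\<in>(J - L) \<union> (nbhd_set E L - J). 1 - 1 / of_nat p powr s i))"

text \<open>
  Increasing tuples \<open>i\<^sub>1 < \<dots> < i\<^sub>j\<close> in \<open>I\<close> are represented by the \<open>j\<close>-element subsets of \<open>I\<close>.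
\<close>

definition expanded_factor ::
    "nat \<Rightarrow> nat set set \<Rightarrow> (nat set \<Rightarrow> int) \<Rightarrow> (nat \<Rightarrow> complex) \<Rightarrow> nat \<Rightarrow> complex" where
  "expanded_factor k E c s p =
     1 - (\<Sum>e\<in>E. 1 / of_nat p powr (\<Sum>i\<in>e. s i))
       + (\<Sum>j = 3..card (non_isolated k E).
            \<Sum>S | S \<subseteq> non_isolated k E \<and> card S = j.
              of_int (c S) / of_nat p powr (\<Sum>i\<in>S. s i))"

definition D' :: "nat set set \<Rightarrow> nat set \<Rightarrow> (nat \<Rightarrow> complex) \<Rightarrow> complex" where
  "D' E J s = euler_prod (cover_factor E J s)"

end

theory Submission
  imports Defs
begin

text \<open>
  For a prime \<open>p\<close> put \<open>x\<^sub>i = p\<close> to the power \<open>-s\<^sub>i\<close> and think of \<open>x\<^sub>i\<close> as the probability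
  that \<open>p\<close> divides \<open>n\<^sub>i\<close>, independently for all \<open>i\<close>. Then \<open>cover_factor\<close> is the probability that
  \<open>A = {i. p dvd n\<^sub>i}\<close> is an independent set, computed by conditioning on \<open>L = A \<inter> J\<close>: as the
  complement of \<open>J\<close> is independent, the only further constraint is that \<open>A\<close> avoids \<open>N(L) - J\<close>.
  Expanding the products gives a multilinear polynomial in the \<open>x\<^sub>i\<close> whose coefficients \<open>c(S)\<close>
  are the Moebius inverse of the indicator of independence. They vanish on singletons and whenever
  \<open>S\<close> contains an isolated vertex, and equal minus the indicator of \<open>E\<close> on pairs.

  For the Dirichlet series, \<open>\<delta>\<^sub>G(n) = 1\<close> iff \<open>{i. p dvd n\<^sub>i}\<close> is independent for every prime
  \<open>p\<close>. Imposing this only for the primes up to \<open>N\<close>, Moebius inversion at each prime turns the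
  indicator into a finite combination of divisibility conditions \<open>d\<^sub>i dvd n\<^sub>i\<close>, and summing these
  yields the product of the zeta values and the Euler product truncated at \<open>N\<close>; dominated
  convergence gives the limit.
\<close>

subsection \<open>Moebius inversion on finite sets\<close>

definition moebius_inverse :: "('a set \<Rightarrow> 'b :: comm_ring_1) \<Rightarrow> 'a set \<Rightarrow> 'b" where
  "moebius_inverse g S = (\<Sum>A\<in>Pow S. (-1) ^ card (S - A) * g A)"

lemma sum_Pow_insert:
  assumes "finite A" "a \<notin> A"
  shows "(\<Sum>S\<in>Pow (insert a A). f S) = (\<Sum>S\<in>Pow A. f S) + (\<Sum>S\<in>Pow A. f (insert a S))"
proof -
  have "inj_on (insert a) (Pow A)" using assms(2) by (auto intro!: inj_onI)
  then show ?thesis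
    unfolding Pow_insert using assms by (subst sum.union_disjoint) (auto simp: sum.reindex)
qed

lemma moebius_inverse_empty [simp]: "moebius_inverse g {} = g {}"
  by (simp add: moebius_inverse_def)

lemma moebius_inverse_insert:
  assumes "finite S" "a \<notin> S"
  shows "moebius_inverse g (insert a S) =
    moebius_inverse (\<lambda>A. g (insert a A)) S - moebius_inverse g S"
proof -
  have "insert a S - A = insert a (S - A)" "insert a S - insert a A = S - A" if "A \<subseteq> S" for A
    using that assms(2) by auto
  then show ?thesis
    using assms by (simp add: moebius_inverse_def sum_Pow_insert flip: sum_negf)
qed

lemma sum_moebius_inverse:
  assumes "finite A"
  shows "(\<Sum>S\<in>Pow A. moebius_inverse g S) = g A"
  using assms
proof (induction A arbitrary: g rule: finite_induct)
  case (insert a A)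
  have "(\<Sum>S\<in>Pow A. moebius_inverse g (insert a S)) =
      (\<Sum>S\<in>Pow A. moebius_inverse (\<lambda>B. g (insert a B)) S - moebius_inverse g S)"
    using insert.hyps by (intro sum.cong refl moebius_inverse_insert) (auto intro: finite_subset)
  then show ?case
    using insert by (simp add: sum_Pow_insert sum_subtractf)
qed simp

lemma of_int_moebius_inverse:
  "of_int (moebius_inverse g S) = moebius_inverse (\<lambda>A. of_int (g A)) S"
  by (simp add: moebius_inverse_def)

subsection \<open>Bernoulli weights\<close>

definition bernoulli_weight :: "'a set \<Rightarrow> ('a \<Rightarrow> 'b :: comm_ring_1) \<Rightarrow> 'a set \<Rightarrow> 'b" where
  "bernoulli_weight V x A = (\<Prod>i\<in>A. x i) * (\<Prod>i\<in>V - A. 1 - x i)"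

lemma sum_bernoulli_weight_interval:
  assumes "finite V" "L \<subseteq> V" "C \<subseteq> V" "L \<inter> C = {}"
  shows "(\<Sum>A | L \<subseteq> A \<and> A \<subseteq> V - C. bernoulli_weight V x A) = (\<Prod>i\<in>L. x i) * (\<Prod>i\<in>C. 1 - x i)"
proof -
  define W where "W = V - L - C"
  have fin: "finite L" "finite C" "finite W"
    using assms by (auto simp: W_def intro: finite_subset)
  have weight: "bernoulli_weight V x (L \<union> M) =
      (\<Prod>i\<in>L. x i) * (\<Prod>i\<in>C. 1 - x i) * ((\<Prod>i\<in>M. x i) * (\<Prod>i\<in>W - M. 1 - x i))"
    if M_subset: "M \<subseteq> W" for M
  proof -
    have "V - (L \<union> M) = C \<union> (W - M)" "L \<inter> M = {}" "C \<inter> (W - M) = {}"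
      using M_subset assms by (auto simp: W_def)
    then show ?thesis
      using fin finite_subset[OF M_subset]
      by (simp add: bernoulli_weight_def prod.union_disjoint mult_ac)
  qed
  have "(\<Sum>A | L \<subseteq> A \<and> A \<subseteq> V - C. bernoulli_weight V x A) =
      (\<Sum>M\<in>Pow W. bernoulli_weight V x (L \<union> M))"
    by (rule sum.reindex_bij_witness[of _ "\<lambda>M. L \<union> M" "\<lambda>A. A - L"])
      (use assms in \<open>auto simp: W_def Un_absorb1\<close>)
  also have "\<dots> = (\<Sum>M\<in>Pow W.
      (\<Prod>i\<in>L. x i) * (\<Prod>i\<in>C. 1 - x i) * ((\<Prod>i\<in>M. x i) * (\<Prod>i\<in>W - M. 1 - x i)))"
    using weight by simp
  also have "\<dots> = (\<Prod>i\<in>L. x i) * (\<Prod>i\<in>C. 1 - x i) * (\<Prod>i\<in>W. x i + (1 - x i))"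
    using fin by (simp only: prod_add sum_distrib_left)
  finally show ?thesis by simp
qed

lemma sum_bernoulli_weight_eq_sum_moebius_inverse:
  assumes "finite V"
  shows "(\<Sum>A\<in>Pow V. g A * bernoulli_weight V x A) =
    (\<Sum>S\<in>Pow V. moebius_inverse g S * (\<Prod>i\<in>S. x i))"
proof -
  have "(\<Sum>A\<in>Pow V. g A * bernoulli_weight V x A) =
      (\<Sum>A\<in>Pow V. \<Sum>S | S \<in> Pow V \<and> S \<subseteq> A. moebius_inverse g S * bernoulli_weight V x A)"
  proof (rule sum.cong[OF refl])
    fix A assume "A \<in> Pow V"
    then have "{S. S \<in> Pow V \<and> S \<subseteq> A} = Pow A" "finite A"
      using assms by (auto intro: finite_subset)
    then show "g A * bernoulli_weight V x A =
        (\<Sum>S | S \<in> Pow V \<and> S \<subseteq> A. moebius_inverse g S * bernoulli_weight V x A)"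
      by (simp add: sum_moebius_inverse flip: sum_distrib_right)
  qed
  also have "\<dots> = (\<Sum>S\<in>Pow V. moebius_inverse g S *
      (\<Sum>A | A \<in> Pow V \<and> S \<subseteq> A. bernoulli_weight V x A))"
    using assms by (subst sum.swap_restrict) (auto simp: sum_distrib_left)
  also have "\<dots> = (\<Sum>S\<in>Pow V. moebius_inverse g S * (\<Prod>i\<in>S. x i))"
    using sum_bernoulli_weight_interval[OF assms, of _ "{}" x]
    by (intro sum.cong) (auto simp: conj_commute)
  finally show ?thesis .
qed

subsection \<open>Unordered sums\<close>

lemma has_sum_dominated_convergence:
  fixes f :: "nat \<Rightarrow> 'a \<Rightarrow> 'b :: {banach, second_countable_topology}"
  assumes sums: "\<And>N. (f N has_sum a N) A" and lim_sums: "a \<longlonglongrightarrow> L"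
    and dominated: "h summable_on A" "\<And>N x. x \<in> A \<Longrightarrow> norm (f N x) \<le> h x"
    and pointwise: "\<And>x. x \<in> A \<Longrightarrow> (\<lambda>N. f N x) \<longlonglongrightarrow> g x"
  shows "(g has_sum L) A"
proof -
  have infsum_eq: "infsum u A = integral\<^sup>L (count_space A) u"
    if "integrable (count_space A) u" for u :: "'a \<Rightarrow> 'b"
    using that infsetsum_infsum[of u A] by (simp add: abs_summable_on_def infsetsum_def)
  have "h summable_on A \<longleftrightarrow> (\<lambda>x. norm (h x)) summable_on A"
    using dominated(2) by (intro summable_on_cong)
      (metis abs_of_nonneg norm_ge_zero order_trans real_norm_def)
  then have "integrable (count_space A) h"
    using dominated(1) abs_summable_equivalent[of h A] by (simp add: abs_summable_on_def)
  then have f_integrable: "integrable (count_space A) (f N)"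
    and g_integrable: "integrable (count_space A) g"
    and "(\<lambda>N. integral\<^sup>L (count_space A) (f N)) \<longlonglongrightarrow> integral\<^sup>L (count_space A) g" for N
    using integrable_dominated_convergence2[of g "count_space A" f h N]
      integrable_dominated_convergence[of g "count_space A" f h]
      integral_dominated_convergence[of g "count_space A" f h] pointwise dominated(2)
    by (auto simp: AE_count_space)
  moreover have "integral\<^sup>L (count_space A) (f N) = a N" for N
    using sums[of N] f_integrable[of N] by (simp add: infsum_eq[symmetric] infsumI)
  ultimately have "infsum g A = L"
    using lim_sums LIMSEQ_unique infsum_eq[OF g_integrable] by simp
  moreover have "g summable_on A"
    using g_integrable abs_summable_equivalent[of g A] abs_summable_summable[of g A]
    by (simp add: abs_summable_on_def)
  ultimately show ?thesis by (simp add: has_sum_iff)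
qed

lemma has_sum_sum:
  fixes f :: "'i \<Rightarrow> 'a \<Rightarrow> 'b :: topological_comm_monoid_add"
  assumes "\<And>i. i \<in> I \<Longrightarrow> (f i has_sum a i) A"
  shows "((\<lambda>x. \<Sum>i\<in>I. f i x) has_sum (\<Sum>i\<in>I. a i)) A"
  using assms by (induction I rule: infinite_finite_induct) (auto intro: has_sum_add)

lemma summable_on_norm_prod_PiE:
  fixes f :: "'a \<Rightarrow> 'b \<Rightarrow> 'c :: {banach, real_normed_field, second_countable_topology}"
  assumes "finite A" "\<And>x. x \<in> A \<Longrightarrow> countable (B x)"
    and "\<And>x. x \<in> A \<Longrightarrow> (\<lambda>y. norm (f x y)) summable_on B x"
  shows "(\<lambda>g. norm (\<Prod>x\<in>A. f x (g x))) summable_on PiE A B"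
  using assms abs_summable_on_prod_PiE[of A B f] by (simp only: abs_summable_equivalent)

lemma has_sum_prod_PiE:
  fixes f :: "'a \<Rightarrow> 'b \<Rightarrow> 'c :: {banach, real_normed_field, second_countable_topology}"
  assumes "finite A" "\<And>x. x \<in> A \<Longrightarrow> countable (B x)"
    and "\<And>x. x \<in> A \<Longrightarrow> (\<lambda>y. norm (f x y)) summable_on B x"
    and "\<And>x. x \<in> A \<Longrightarrow> (f x has_sum s x) (B x)"
  shows "((\<lambda>g. \<Prod>x\<in>A. f x (g x)) has_sum (\<Prod>x\<in>A. s x)) (PiE A B)"
proof -
  have "(\<Sum>\<^sub>\<infinity>g\<in>PiE A B. \<Prod>x\<in>A. f x (g x)) = (\<Prod>x\<in>A. s x)"
    using assms infsum_prod_PiE_abs[of A f B] by (auto simp: infsumI intro!: prod.cong)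
  then show ?thesis
    using abs_summable_summable[OF summable_on_norm_prod_PiE[OF assms(1-3)]]
    by (simp add: has_sum_iff)
qed

subsection \<open>Completely multiplicative functions\<close>

definition completely_multiplicative :: "(nat \<Rightarrow> 'a :: comm_monoid_mult) \<Rightarrow> bool" where
  "completely_multiplicative f \<longleftrightarrow> f 1 = 1 \<and> (\<forall>m n. f (m * n) = f m * f n)"

lemma completely_multiplicative_prod:
  assumes "completely_multiplicative f"
  shows "f (\<Prod>i\<in>I. g i) = (\<Prod>i\<in>I. f (g i))"
  using assms unfolding completely_multiplicative_def
  by (induction I rule: infinite_finite_induct) auto

lemma has_sum_multiples:
  fixes f :: "nat \<Rightarrow> 'a :: {comm_semiring_1, topological_semigroup_mult}"
  assumes "completely_multiplicative f" "(f has_sum a) {1..}" "d \<ge> 1"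
  shows "((\<lambda>n. of_bool (d dvd n) * f n) has_sum (f d * a)) {1..}"
proof -
  have "((\<lambda>n. of_bool (d dvd n) * f n) \<circ> (\<lambda>n. d * n) has_sum (f d * a)) {1..}"
    using assms(1) has_sum_cmult_right[OF assms(2), of "f d"]
    by (simp add: completely_multiplicative_def o_def)
  then have "((\<lambda>n. of_bool (d dvd n) * f n) has_sum (f d * a)) ((\<lambda>n. d * n) ` {1..})"
    using assms(3) by (subst has_sum_reindex) (auto simp: inj_on_def)
  then show ?thesis
    using assms(3) by (subst has_sum_cong_neutral[where T = "(\<lambda>n. d * n) ` {1..}"])
      (auto elim!: dvdE)
qed

lemma has_sum_prod_multiples:
  fixes f :: "'i \<Rightarrow> nat \<Rightarrow> 'a :: {banach, real_normed_field, second_countable_topology}"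
  assumes "finite V" "\<And>i. i \<in> V \<Longrightarrow> completely_multiplicative (f i)"
    and "\<And>i. i \<in> V \<Longrightarrow> (\<lambda>n. norm (f i n)) summable_on {1..}"
    and "\<And>i. i \<in> V \<Longrightarrow> (f i has_sum a i) {1..}"
    and "\<And>i. i \<in> V \<Longrightarrow> d i \<ge> 1"
  shows "((\<lambda>n. \<Prod>i\<in>V. of_bool (d i dvd n i) * f i (n i)) has_sum (\<Prod>i\<in>V. f i (d i) * a i))
    (PiE V (\<lambda>_. {1..}))"
proof (rule has_sum_prod_PiE[OF assms(1)])
  fix i assume "i \<in> V"
  then show "((\<lambda>n. of_bool (d i dvd n) * f i n) has_sum (f i (d i) * a i)) {1..}"
    using assms by (intro has_sum_multiples) auto
  show "(\<lambda>n. norm (of_bool (d i dvd n) * f i n)) summable_on {1..}"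
    by (rule Infinite_Sum.abs_summable_on_comparison_test[OF assms(3)[OF \<open>i \<in> V\<close>]])
      (auto simp: norm_mult)
qed auto

lemma prod_dvd_iff_pairwise_coprime:
  fixes m :: "'a :: semiring_gcd"
  assumes "finite Q" "pairwise coprime Q"
  shows "\<Prod>Q dvd m \<longleftrightarrow> (\<forall>q\<in>Q. q dvd m)"
  using assms
proof (induction Q rule: finite_induct)
  case (insert q Q)
  have "coprime q (\<Prod>Q)"
    using insert by (intro prod_coprime_right) (auto simp: pairwise_insert)
  then show ?case
    using insert
    by (auto simp: pairwise_insert intro: divides_mult dest: dvd_mult_left dvd_mult_right)
qed simp

lemma prod_of_bool:
  assumes "finite Q"
  shows "(\<Prod>q\<in>Q. of_bool (P q)) = (of_bool (\<forall>q\<in>Q. P q) :: 'a :: comm_semiring_1)"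
  using assms by (induction Q rule: finite_induct) auto

lemma of_bool_prod_primes_dvd:
  fixes m :: nat
  assumes "finite Q" "\<And>q. q \<in> Q \<Longrightarrow> prime q"
  shows "(of_bool (\<Prod>Q dvd m) :: 'a :: comm_semiring_1) = (\<Prod>q\<in>Q. of_bool (q dvd m))"
proof -
  have "pairwise coprime Q"
    using assms(2) by (auto simp: pairwise_def intro: primes_coprime)
  then show ?thesis
    using assms(1) by (simp add: prod_dvd_iff_pairwise_coprime prod_of_bool)
qed

lemma sum_Pow_Collect_eq:
  fixes c :: "'i set \<Rightarrow> 'a :: comm_semiring_1"
  assumes "finite V"
  shows "(\<Sum>S\<in>Pow {i \<in> V. R i}. c S) = (\<Sum>S\<in>Pow V. c S * (\<Prod>i\<in>S. of_bool (R i)))"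
  using assms
  by (intro sum.mono_neutral_cong_left)
    (auto simp: prod_of_bool finite_subset split: split_of_bool_asm)

lemma prod_sum_Pow_eq_sum_PiE:
  fixes c :: "'q \<Rightarrow> 'i set \<Rightarrow> 'a :: comm_semiring_1"
  assumes "finite Q" "finite V"
  shows "(\<Prod>q\<in>Q. \<Sum>S\<in>Pow V. c q S * (\<Prod>i\<in>S. g i q)) =
    (\<Sum>T\<in>Q \<rightarrow>\<^sub>E Pow V. (\<Prod>q\<in>Q. c q (T q)) * (\<Prod>i\<in>V. \<Prod>q | q \<in> Q \<and> i \<in> T q. g i q))"
proof -
  have swap: "(\<Prod>q\<in>Q. \<Prod>i\<in>T q. g i q) = (\<Prod>i\<in>V. \<Prod>q | q \<in> Q \<and> i \<in> T q. g i q)"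
    if "T \<in> Q \<rightarrow>\<^sub>E Pow V" for T
  proof -
    have "(\<Prod>q\<in>Q. \<Prod>i\<in>T q. g i q) = (\<Prod>q\<in>Q. \<Prod>i | i \<in> V \<and> i \<in> T q. g i q)"
      using that by (intro prod.cong) (auto simp: PiE_iff)
    then show ?thesis
      using prod.swap_restrict[OF assms, of "\<lambda>q i. g i q" "\<lambda>q i. i \<in> T q"] by simp
  qed
  have "(\<Prod>q\<in>Q. \<Sum>S\<in>Pow V. c q S * (\<Prod>i\<in>S. g i q)) =
      (\<Sum>T\<in>Q \<rightarrow>\<^sub>E Pow V. (\<Prod>q\<in>Q. c q (T q)) * (\<Prod>q\<in>Q. \<Prod>i\<in>T q. g i q))"
    using assms by (subst prod_sum_PiE) (auto simp: prod.distrib)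
  then show ?thesis by (simp add: swap)
qed

theorem has_sum_prod_sum_prime_divisibility:
  fixes f :: "'i \<Rightarrow> nat \<Rightarrow> 'a :: {banach, real_normed_field, second_countable_topology}"
  assumes finite_V: "finite V"
    and mult: "\<And>i. i \<in> V \<Longrightarrow> completely_multiplicative (f i)"
    and abs_summable: "\<And>i. i \<in> V \<Longrightarrow> (\<lambda>n. norm (f i n)) summable_on {1..}"
    and sums: "\<And>i. i \<in> V \<Longrightarrow> (f i has_sum a i) {1..}"
    and primes: "finite Q" "\<And>q. q \<in> Q \<Longrightarrow> prime q"
  shows "((\<lambda>n. (\<Prod>q\<in>Q. \<Sum>S\<in>Pow {i \<in> V. q dvd n i}. c q S) * (\<Prod>i\<in>V. f i (n i))) has_sum
      (\<Prod>q\<in>Q. \<Sum>S\<in>Pow V. c q S * (\<Prod>i\<in>S. f i q)) * (\<Prod>i\<in>V. a i)) (PiE V (\<lambda>_. {1..}))"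
proof -
  define d where "d T i = \<Prod>{q \<in> Q. i \<in> T q}" for T :: "nat \<Rightarrow> 'i set" and i
  have d_pos: "d T i \<ge> 1" for T i
    using primes prime_gt_0_nat unfolding d_def by (auto simp: Suc_le_eq intro!: prod_pos)
  have "((\<lambda>n. \<Sum>T\<in>Q \<rightarrow>\<^sub>E Pow V. (\<Prod>q\<in>Q. c q (T q)) *
        (\<Prod>i\<in>V. of_bool (d T i dvd n i) * f i (n i))) has_sum
      (\<Sum>T\<in>Q \<rightarrow>\<^sub>E Pow V. (\<Prod>q\<in>Q. c q (T q)) * (\<Prod>i\<in>V. f i (d T i) * a i))) (PiE V (\<lambda>_. {1..}))"
    using finite_V mult abs_summable sums d_pos
    by (intro has_sum_sum has_sum_cmult_right has_sum_prod_multiples)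
  also have "(\<Sum>T\<in>Q \<rightarrow>\<^sub>E Pow V. (\<Prod>q\<in>Q. c q (T q)) * (\<Prod>i\<in>V. f i (d T i) * a i)) =
      (\<Prod>q\<in>Q. \<Sum>S\<in>Pow V. c q S * (\<Prod>i\<in>S. f i q)) * (\<Prod>i\<in>V. a i)"
    using mult by (simp add: prod_sum_Pow_eq_sum_PiE[OF primes(1) finite_V] d_def
      completely_multiplicative_prod prod.distrib sum_distrib_left mult_ac)
  also have "(\<lambda>n. \<Sum>T\<in>Q \<rightarrow>\<^sub>E Pow V. (\<Prod>q\<in>Q. c q (T q)) *
        (\<Prod>i\<in>V. of_bool (d T i dvd n i) * f i (n i))) =
      (\<lambda>n. (\<Prod>q\<in>Q. \<Sum>S\<in>Pow {i \<in> V. q dvd n i}. c q S) * (\<Prod>i\<in>V. f i (n i)))"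
  proof
    fix n :: "'i \<Rightarrow> nat"
    have "of_bool (d T i dvd m) = (\<Prod>q | q \<in> Q \<and> i \<in> T q. of_bool (q dvd m) :: 'a)" for T i m
      unfolding d_def using primes by (intro of_bool_prod_primes_dvd) auto
    then show "(\<Sum>T\<in>Q \<rightarrow>\<^sub>E Pow V. (\<Prod>q\<in>Q. c q (T q)) *
          (\<Prod>i\<in>V. of_bool (d T i dvd n i) * f i (n i))) =
        (\<Prod>q\<in>Q. \<Sum>S\<in>Pow {i \<in> V. q dvd n i}. c q S) * (\<Prod>i\<in>V. f i (n i))"
      by (simp add: sum_Pow_Collect_eq[OF finite_V] prod_sum_Pow_eq_sum_PiE[OF primes(1) finite_V]
        prod.distrib sum_distrib_left mult_ac)
  qed
  finally show ?thesis .
qed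

subsection \<open>Euler products\<close>

lemma euler_prod_cong:
  assumes "\<And>p. prime p \<Longrightarrow> f p = g p"
  shows "euler_prod f = euler_prod g"
  unfolding euler_prod_def using assms by (intro arg_cong[where f = prodinf]) auto

lemma abs_convergent_euler_prod_cong:
  assumes "\<And>p. prime p \<Longrightarrow> f p = g p"
  shows "abs_convergent_euler_prod f \<longleftrightarrow> abs_convergent_euler_prod g"
  unfolding abs_convergent_euler_prod_def
  using assms by (intro arg_cong[where f = abs_convergent_prod]) auto

lemma abs_convergent_euler_prod_LIMSEQ:
  assumes "abs_convergent_euler_prod f"
  shows "(\<lambda>N. \<Prod>p | prime p \<and> p \<le> N. f p) \<longlonglongrightarrow> euler_prod f"
proof -
  have "(\<lambda>N. \<Prod>p\<le>N. if prime p then f p else 1) \<longlonglongrightarrow> euler_prod f"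
    using assms unfolding euler_prod_def abs_convergent_euler_prod_def
    by (intro convergent_prod_LIMSEQ abs_convergent_prod_imp_convergent_prod)
  moreover have "(\<Prod>p\<le>N. if prime p then f p else 1) = (\<Prod>p | prime p \<and> p \<le> N. f p)" for N
    by (rule prod.mono_neutral_cong_right) auto
  ultimately show ?thesis by simp
qed

lemma norm_one_over_nat_powr: "norm (1 / of_nat n powr s :: complex) = real n powr - Re s"
  by (simp add: norm_divide norm_powr_real_powr powr_minus_divide)

lemma abs_convergent_euler_prod_one_plus_sum:
  assumes "\<And>p. prime p \<Longrightarrow> f p = 1 + (\<Sum>b\<in>B. a b / of_nat p powr t b)"
    and "\<And>b. b \<in> B \<Longrightarrow> Re (t b) > 1"
  shows "abs_convergent_euler_prod f"
  unfolding abs_convergent_euler_prod_def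
proof (rule summable_imp_abs_convergent_prod, rule summable_comparison_test', rule summable_sum)
  let ?h = "\<lambda>b p. norm (a b) * real p powr - Re (t b)"
  show "summable (?h b)" if "b \<in> B" for b
    using assms(2)[OF that] by (intro summable_mult) (simp add: summable_real_powr_iff)
  show "norm (norm ((if prime p then f p else 1) - 1)) \<le> (\<Sum>b\<in>B. ?h b p)" if "p \<ge> 0" for p
  proof (cases "prime p")
    case True
    have "norm (\<Sum>b\<in>B. a b * (1 / of_nat p powr t b)) \<le> (\<Sum>b\<in>B. ?h b p)"
      unfolding norm_one_over_nat_powr[symmetric] norm_mult[symmetric] by (rule norm_sum)
    then show ?thesis using True assms(1) by simp
  qed (simp add: sum_nonneg)
qed

lemma all_primes_le_iff_all_primes:
  fixes n :: "'i \<Rightarrow> nat"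
  assumes "\<And>i. i \<in> V \<Longrightarrow> 0 < n i" "\<And>i. i \<in> V \<Longrightarrow> n i \<le> N" "\<And>p. prime p \<Longrightarrow> P p {}"
  shows "(\<forall>p. prime p \<and> p \<le> N \<longrightarrow> P p {i \<in> V. p dvd n i}) \<longleftrightarrow>
    (\<forall>p. prime p \<longrightarrow> P p {i \<in> V. p dvd n i})"
proof -
  have "P p {i \<in> V. p dvd n i}" if "prime p" "\<not> p \<le> N" for p
  proof -
    have "\<not> p dvd n i" if "i \<in> V" for i
      using assms(1,2)[OF that] \<open>\<not> p \<le> N\<close> dvd_imp_le[of p "n i"] by auto
    then have "{i \<in> V. p dvd n i} = {}" by blast
    then show ?thesis by (simp only: assms(3)[OF \<open>prime p\<close>])
  qed
  then show ?thesis by blast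
qed

theorem has_sum_prime_local_condition:
  fixes f :: "'i \<Rightarrow> nat \<Rightarrow> complex"
  assumes finite_V: "finite V"
    and mult: "\<And>i. i \<in> V \<Longrightarrow> completely_multiplicative (f i)"
    and abs_summable: "\<And>i. i \<in> V \<Longrightarrow> (\<lambda>n. norm (f i n)) summable_on {1..}"
    and sums: "\<And>i. i \<in> V \<Longrightarrow> (f i has_sum a i) {1..}"
    and P_empty: "\<And>p. prime p \<Longrightarrow> P p {}"
    and conv: "abs_convergent_euler_prod
      (\<lambda>p. \<Sum>A\<in>Pow V. of_bool (P p A) * bernoulli_weight V (\<lambda>i. f i p) A)"
      (is "abs_convergent_euler_prod ?F")
  shows "((\<lambda>n. of_bool (\<forall>p. prime p \<longrightarrow> P p {i \<in> V. p dvd n i}) * (\<Prod>i\<in>V. f i (n i))) has_sum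
    (\<Prod>i\<in>V. a i) * euler_prod ?F) (PiE V (\<lambda>_. {1..}))"
proof (rule has_sum_dominated_convergence)
  let ?Q = "\<lambda>N :: nat. {p. prime p \<and> p \<le> N}"
  let ?w = "\<lambda>n. \<Prod>i\<in>V. f i (n i)"
  let ?D = "\<lambda>N n. of_bool (\<forall>p\<in>?Q N. P p {i \<in> V. p dvd n i}) :: complex"
  let ?c = "\<lambda>p. moebius_inverse (\<lambda>A. of_bool (P p A) :: complex)"
  have D_eq_prod: "?D N n = (\<Prod>p\<in>?Q N. \<Sum>S\<in>Pow {i \<in> V. p dvd n i}. ?c p S)" for N n
    using finite_V by (simp add: sum_moebius_inverse prod_of_bool)
  have F_eq: "?F p = (\<Sum>S\<in>Pow V. ?c p S * (\<Prod>i\<in>S. f i p))" for p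
    by (rule sum_bernoulli_weight_eq_sum_moebius_inverse[OF finite_V])
  have "((\<lambda>n. (\<Prod>p\<in>?Q N. \<Sum>S\<in>Pow {i \<in> V. p dvd n i}. ?c p S) * ?w n) has_sum
      (\<Prod>p\<in>?Q N. \<Sum>S\<in>Pow V. ?c p S * (\<Prod>i\<in>S. f i p)) * (\<Prod>i\<in>V. a i)) (PiE V (\<lambda>_. {1..}))" for N
    using finite_V mult abs_summable sums by (intro has_sum_prod_sum_prime_divisibility) auto
  then show "((\<lambda>n. ?D N n * ?w n) has_sum (\<Prod>i\<in>V. a i) * (\<Prod>p\<in>?Q N. ?F p)) (PiE V (\<lambda>_. {1..}))" for N
    unfolding D_eq_prod F_eq by (simp only: mult.commute)
  show "(\<lambda>N. (\<Prod>i\<in>V. a i) * (\<Prod>p\<in>?Q N. ?F p)) \<longlonglongrightarrow> (\<Prod>i\<in>V. a i) * euler_prod ?F"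
    by (intro tendsto_mult tendsto_const abs_convergent_euler_prod_LIMSEQ conv)
  show "(\<lambda>n. norm (?w n)) summable_on PiE V (\<lambda>_. {1..})"
    using finite_V abs_summable by (intro summable_on_norm_prod_PiE) auto
  show "norm (?D N n * ?w n) \<le> norm (?w n)" for N n by simp
  fix n assume n_pos: "n \<in> PiE V (\<lambda>_. {1..} :: nat set)"
  have D_eq: "?D N n = of_bool (\<forall>p. prime p \<longrightarrow> P p {i \<in> V. p dvd n i})" if N_ge: "N \<ge> sum n V" for N
  proof -
    have "0 < n i" "n i \<le> N" if "i \<in> V" for i
      using member_le_sum[of i V n] finite_V that N_ge n_pos by (auto simp: PiE_iff Suc_le_eq)
    then show ?thesis
      by (simp only: all_primes_le_iff_all_primes[of V n N P] P_empty mem_Collect_eq Ball_def)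
  qed
  show "(\<lambda>N. ?D N n * ?w n) \<longlonglongrightarrow>
      of_bool (\<forall>p. prime p \<longrightarrow> P p {i \<in> V. p dvd n i}) * ?w n"
    by (intro tendsto_eventually eventually_mono[OF eventually_ge_at_top[of "sum n V"]])
      (simp only: D_eq)
qed

subsection \<open>Independent sets and vertex covers\<close>

definition indep_coeff :: "nat set set \<Rightarrow> nat set \<Rightarrow> int" where
  "indep_coeff E = moebius_inverse (\<lambda>A. of_bool (independent_set E A))"

lemma indep_coeff_empty: "indep_coeff E {} = 1"
  by (simp add: indep_coeff_def independent_set_def)

lemma indep_coeff_singleton:
  assumes "{i} \<notin> E"
  shows "indep_coeff E {i} = 0"
  using assms by (simp add: indep_coeff_def moebius_inverse_insert independent_set_def)

lemma indep_coeff_pair: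
  assumes "{i} \<notin> E" "{j} \<notin> E" "i \<noteq> j"
  shows "indep_coeff E {i, j} = - of_bool ({i, j} \<in> E)"
proof -
  have "independent_set E {i, j} \<longleftrightarrow> {i, j} \<notin> E"
    using assms by (auto simp: independent_set_def insert_commute)
  then show ?thesis
    using assms by (simp add: indep_coeff_def moebius_inverse_insert independent_set_def)
qed

lemma indep_coeff_isolated:
  assumes "finite S" "v \<in> S" "\<And>i. {v, i} \<notin> E"
  shows "indep_coeff E S = 0"
proof -
  have "independent_set E (insert v A) \<longleftrightarrow> independent_set E A" for A
    using assms(3) by (auto simp: independent_set_def insert_commute)
  then have "indep_coeff E (insert v (S - {v})) = 0"
    using assms(1) unfolding indep_coeff_def by (subst moebius_inverse_insert) auto
  then show ?thesis using assms(2) by (simp add: insert_absorb)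
qed

lemma simple_graph_edgeD:
  assumes "simple_graph k E" "{i, j} \<in> E"
  shows "i \<in> {1..k}" "j \<in> {1..k}" "i \<noteq> j"
proof -
  obtain a b where "{i, j} = {a, b}" "1 \<le> a" "a < b" "b \<le> k"
    using assms unfolding simple_graph_def by blast
  then show "i \<in> {1..k}" "j \<in> {1..k}" "i \<noteq> j"
    by (auto simp: doubleton_eq_iff)
qed

lemma independent_Int_cover_eq_iff:
  assumes cover: "vertex_cover k E J" and "L \<subseteq> J" and L_indep: "independent_set E L"
  shows "A \<subseteq> {1..k} \<and> independent_set E A \<and> A \<inter> J = L \<longleftrightarrow>
    L \<subseteq> A \<and> A \<subseteq> {1..k} - ((J - L) \<union> (nbhd_set E L - J))"
proof
  assume "A \<subseteq> {1..k} \<and> independent_set E A \<and> A \<inter> J = L"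
  then show "L \<subseteq> A \<and> A \<subseteq> {1..k} - ((J - L) \<union> (nbhd_set E L - J))"
    by (auto simp: independent_set_def nbhd_set_def nbhd_def)
next
  assume A_between: "L \<subseteq> A \<and> A \<subseteq> {1..k} - ((J - L) \<union> (nbhd_set E L - J))"
  then have A_Int_J: "A \<inter> J = L" using \<open>L \<subseteq> J\<close> by auto
  have edge_meets_J: "i \<in> J \<or> j \<in> J" if "{i, j} \<in> E" for i j
    using cover that by (auto simp: vertex_cover_def)
  have no_edge_from_J: "{i, j} \<notin> E" if "i \<in> A \<inter> J" "j \<in> A" for i j
  proof
    assume edge: "{i, j} \<in> E"
    then have "j \<in> nbhd_set E L"
      using that A_Int_J by (auto simp: nbhd_set_def nbhd_def insert_commute)
    then have "j \<in> L" using A_between that A_Int_J by auto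
    then show False using edge that A_Int_J L_indep by (auto simp: independent_set_def)
  qed
  have "{i, j} \<notin> E" if "i \<in> A" "j \<in> A" for i j
    using edge_meets_J[of i j] no_edge_from_J[of i j] no_edge_from_J[of j i] that
    by (auto simp: insert_commute)
  then show "A \<subseteq> {1..k} \<and> independent_set E A \<and> A \<inter> J = L"
    using A_between A_Int_J by (auto simp: independent_set_def)
qed

lemma sum_independent_cover_eq_sum_bernoulli_weight:
  fixes x :: "nat \<Rightarrow> 'a :: comm_ring_1"
  assumes graph: "simple_graph k E" and cover: "vertex_cover k E J"
  shows "(\<Sum>L | L \<subseteq> J \<and> independent_set E L.
      (\<Prod>l\<in>L. x l) * (\<Prod>i\<in>(J - L) \<union> (nbhd_set E L - J). 1 - x i)) =
    (\<Sum>A\<in>Pow {1..k}. of_bool (independent_set E A) * bernoulli_weight {1..k} x A)"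
proof -
  let ?weight = "bernoulli_weight {1..k} x"
  let ?indep = "\<lambda>V. {A. A \<subseteq> V \<and> independent_set E A}"
  let ?C = "\<lambda>L. (J - L) \<union> (nbhd_set E L - J)"
  have J_subset: "J \<subseteq> {1..k}" using cover by (simp add: vertex_cover_def)
  then have fin: "finite (?indep J)" by (simp add: finite_subset)
  have C_subset: "?C L \<subseteq> {1..k}" for L
    using simple_graph_edgeD[OF graph] J_subset by (auto simp: nbhd_set_def nbhd_def)
  have "(\<Sum>L\<in>?indep J. (\<Prod>l\<in>L. x l) * (\<Prod>i\<in>?C L. 1 - x i)) =
      (\<Sum>L\<in>?indep J. \<Sum>A | A \<in> ?indep {1..k} \<and> A \<inter> J = L. ?weight A)"
  proof (rule sum.cong[OF refl])
    fix L assume L: "L \<in> ?indep J"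
    have "(\<Sum>A | L \<subseteq> A \<and> A \<subseteq> {1..k} - ?C L. ?weight A) = (\<Prod>l\<in>L. x l) * (\<Prod>i\<in>?C L. 1 - x i)"
      using L J_subset C_subset[of L] by (intro sum_bernoulli_weight_interval) auto
    also have "{A. L \<subseteq> A \<and> A \<subseteq> {1..k} - ?C L} = {A. A \<in> ?indep {1..k} \<and> A \<inter> J = L}"
      using independent_Int_cover_eq_iff[OF cover, of L] L by auto
    finally show "(\<Prod>l\<in>L. x l) * (\<Prod>i\<in>?C L. 1 - x i) =
        (\<Sum>A | A \<in> ?indep {1..k} \<and> A \<inter> J = L. ?weight A)" ..
  qed
  also have "\<dots> = (\<Sum>A\<in>?indep {1..k}. ?weight A)"
    using fin by (intro sum.group) (auto simp: independent_set_def)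
  also have "\<dots> = (\<Sum>A\<in>Pow {1..k}. of_bool (independent_set E A) * ?weight A)"
    by (rule sum.mono_neutral_cong_left) auto
  finally show ?thesis .
qed

lemma cover_factor_eq_sum_bernoulli_weight:
  assumes "simple_graph k E" "vertex_cover k E J"
  shows "cover_factor E J s p = (\<Sum>A\<in>Pow {1..k}.
    of_bool (independent_set E A) * bernoulli_weight {1..k} (\<lambda>i. 1 / of_nat p powr s i) A)"
  unfolding cover_factor_def by (rule sum_independent_cover_eq_sum_bernoulli_weight[OF assms])

lemma finite_non_isolated: "finite (non_isolated k E)"
  by (simp add: non_isolated_def)

lemma indep_coeff_eq_0:
  assumes graph: "simple_graph k E" and S_subset: "S \<subseteq> {1..k}"
    and "S \<noteq> {}" "\<not> (S \<subseteq> non_isolated k E \<and> 2 \<le> card S)"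
  shows "indep_coeff E S = 0"
proof -
  have fin: "finite S" using S_subset by (auto intro: finite_subset)
  then consider (singleton) "card S = 1" | (isolated) v where "v \<in> S" "v \<notin> non_isolated k E"
    using assms card_gt_0_iff[of S] by (cases "S \<subseteq> non_isolated k E") auto
  then show ?thesis
  proof cases
    case singleton
    then obtain i where "S = {i}" by (auto simp: card_1_singleton_iff)
    then show ?thesis
      using simple_graph_edgeD(3)[OF graph, of i i] by (auto intro: indep_coeff_singleton)
  next
    case isolated
    then show ?thesis
      using S_subset fin by (intro indep_coeff_isolated[of S v]) (auto simp: non_isolated_def)
  qed
qed

lemma cover_factor_eq_sum_card_ge_2:
  assumes graph: "simple_graph k E" and cover: "vertex_cover k E J" and p_pos: "p > 0"
  shows "cover_factor E J s p = 1 + (\<Sum>S | S \<subseteq> non_isolated k E \<and> 2 \<le> card S.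
    of_int (indep_coeff E S) / of_nat p powr (\<Sum>i\<in>S. s i))"
proof -
  define g where "g S = of_int (indep_coeff E S) / of_nat p powr (\<Sum>i\<in>S. s i)" for S
  let ?B = "{S. S \<subseteq> non_isolated k E \<and> 2 \<le> card S}"
  have "cover_factor E J s p =
      (\<Sum>S\<in>Pow {1..k}. of_int (indep_coeff E S) * (\<Prod>i\<in>S. 1 / of_nat p powr s i))"
    unfolding cover_factor_eq_sum_bernoulli_weight[OF graph cover] indep_coeff_def
      of_int_moebius_inverse of_int_of_bool
    by (rule sum_bernoulli_weight_eq_sum_moebius_inverse) simp
  also have "\<dots> = (\<Sum>S\<in>Pow {1..k}. g S)"
    using p_pos by (simp add: g_def powr_sum prod_dividef)
  also have "\<dots> = (\<Sum>S\<in>insert {} ?B. g S)"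
  proof (rule sum.mono_neutral_right)
    show "insert {} ?B \<subseteq> Pow {1..k}" by (auto simp: non_isolated_def)
    show "\<forall>S\<in>Pow {1..k} - insert {} ?B. g S = 0"
      using indep_coeff_eq_0[OF graph] by (simp add: g_def)
  qed simp
  also have "\<dots> = g {} + (\<Sum>S\<in>?B. g S)"
    using finite_non_isolated[of k E] by (subst sum.insert) auto
  finally show ?thesis using p_pos by (simp add: g_def indep_coeff_empty)
qed

lemma simple_graph_edge_subset_non_isolated:
  assumes graph: "simple_graph k E" and edge: "e \<in> E"
  shows "e \<subseteq> non_isolated k E" "card e = 2"
proof -
  obtain i j where "e = {i, j}" using edge graph unfolding simple_graph_def by blast
  moreover from this have "{i, j} \<in> E" "{j, i} \<in> E" using edge by (simp_all add: insert_commute)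
  ultimately show "e \<subseteq> non_isolated k E" "card e = 2"
    using simple_graph_edgeD[OF graph, of i j] by (auto simp: non_isolated_def)
qed

lemma sum_indep_coeff_card_2:
  fixes x :: "nat set \<Rightarrow> 'a :: comm_ring_1"
  assumes graph: "simple_graph k E"
  shows "(\<Sum>S | S \<subseteq> non_isolated k E \<and> card S = 2. of_int (indep_coeff E S) * x S) = - (\<Sum>e\<in>E. x e)"
proof -
  let ?B = "{S. S \<subseteq> non_isolated k E \<and> card S = 2}"
  have coeff: "indep_coeff E S = - of_bool (S \<in> E)" if S_pair: "S \<in> ?B" for S
  proof -
    obtain i j where "S = {i, j}" "i \<noteq> j" using S_pair by (auto simp: card_2_iff)
    moreover have "{v} \<notin> E" for v
      using simple_graph_edge_subset_non_isolated(2)[OF graph, of "{v}"] by auto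
    ultimately show ?thesis by (simp add: indep_coeff_pair)
  qed
  have "(\<Sum>S\<in>?B. of_int (indep_coeff E S) * x S) = (\<Sum>e\<in>E. - x e)"
    using simple_graph_edge_subset_non_isolated[OF graph] finite_non_isolated[of k E]
    by (intro sum.mono_neutral_cong_right) (auto simp: coeff)
  then show ?thesis by (simp add: sum_negf)
qed

lemma cover_factor_eq_expanded_factor:
  assumes graph: "simple_graph k E" and cover: "vertex_cover k E J" and p_pos: "p > 0"
  shows "cover_factor E J s p = expanded_factor k E (indep_coeff E) s p"
proof -
  define I where "I = non_isolated k E"
  have fin: "finite I" by (simp add: I_def finite_non_isolated)
  define g where "g S = of_int (indep_coeff E S) * (1 / of_nat p powr (\<Sum>i\<in>S. s i))" for S
  have "cover_factor E J s p = 1 + (\<Sum>S | S \<subseteq> I \<and> 2 \<le> card S. g S)"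
    by (simp add: cover_factor_eq_sum_card_ge_2[OF assms] g_def I_def)
  also have "{S. S \<subseteq> I \<and> 2 \<le> card S} = {S. S \<subseteq> I \<and> card S = 2} \<union> {S. S \<subseteq> I \<and> 3 \<le> card S}"
    by auto
  also have "(\<Sum>S\<in>\<dots>. g S) = (\<Sum>S | S \<subseteq> I \<and> card S = 2. g S) + (\<Sum>S | S \<subseteq> I \<and> 3 \<le> card S. g S)"
    using fin by (intro sum.union_disjoint) auto
  also have "(\<Sum>S | S \<subseteq> I \<and> card S = 2. g S) = - (\<Sum>e\<in>E. 1 / of_nat p powr (\<Sum>i\<in>e. s i))"
    unfolding g_def I_def by (rule sum_indep_coeff_card_2[OF graph])
  also have "(\<Sum>S | S \<subseteq> I \<and> 3 \<le> card S. g S) =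
      (\<Sum>j = 3..card I. \<Sum>S | S \<in> {S. S \<subseteq> I \<and> 3 \<le> card S} \<and> card S = j. g S)"
    using fin by (intro sum.group[symmetric]) (auto intro: card_mono)
  also have "\<dots> = (\<Sum>j = 3..card I. \<Sum>S | S \<subseteq> I \<and> card S = j. g S)"
    by (intro sum.cong) auto
  finally show ?thesis by (simp add: expanded_factor_def g_def I_def)
qed

lemma abs_convergent_euler_prod_cover_factor:
  assumes graph: "simple_graph k E" and cover: "vertex_cover k E J"
    and Re_gt_1: "\<And>S. S \<subseteq> non_isolated k E \<Longrightarrow> 2 \<le> card S \<Longrightarrow> Re (\<Sum>i\<in>S. s i) > 1"
  shows "abs_convergent_euler_prod (cover_factor E J s)"
  using cover_factor_eq_sum_card_ge_2[OF graph cover] Re_gt_1 prime_gt_0_nat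
  by (intro abs_convergent_euler_prod_one_plus_sum) auto

subsection \<open>The Dirichlet series\<close>

lemma completely_multiplicative_one_over_powr:
  "completely_multiplicative (\<lambda>n. 1 / of_nat n powr s :: complex)"
  by (simp add: completely_multiplicative_def powr_times_real)

lemma zeta_series:
  assumes "Re s > 1"
  shows "(\<lambda>n. norm (1 / of_nat n powr s :: complex)) summable_on {1..}"
    and "((\<lambda>n. 1 / of_nat n powr s) has_sum zeta s) {1..}"
proof -
  let ?f = "\<lambda>n. 1 / of_nat n powr s :: complex"
  have range_Suc: "{1..} = range Suc" using greaterThan_0 by (auto simp: greaterThan_def)
  have "summable (\<lambda>n. real n powr - Re s)"
    using assms by (simp add: summable_real_powr_iff)
  then have norm_summable: "summable (\<lambda>n. norm (?f (Suc n)))"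
    unfolding norm_one_over_nat_powr by (subst summable_Suc_iff)
  then show "(\<lambda>n. norm (?f n)) summable_on {1..}"
    unfolding range_Suc using norm_summable_imp_summable_on[of "\<lambda>n. norm (?f (Suc n))"]
    by (subst summable_on_reindex) (auto simp: o_def)
  have "((\<lambda>n. ?f (Suc n)) has_sum zeta s) UNIV"
    unfolding zeta_def
    by (intro norm_summable_imp_has_sum norm_summable summable_sums
      summable_norm_cancel[OF norm_summable])
  then show "(?f has_sum zeta s) {1..}"
    unfolding range_Suc by (subst has_sum_reindex) (auto simp: o_def)
qed

lemma delta_eq_prime_local_condition:
  assumes graph: "simple_graph k E"
  shows "delta E n = of_bool (\<forall>p. prime p \<longrightarrow> independent_set E {i \<in> {1..k}. p dvd n i})"
proof -
  have "gcd (n i) (n j) = 1 \<longleftrightarrow> (\<forall>p. prime p \<longrightarrow> \<not> (p dvd n i \<and> p dvd n j))" for i j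
    by (metis gcd_greatest_iff not_prime_unit prime_factor_nat)
  then have "(\<forall>i j. {i, j} \<in> E \<longrightarrow> gcd (n i) (n j) = 1) \<longleftrightarrow>
      (\<forall>p. prime p \<longrightarrow> independent_set E {i \<in> {1..k}. p dvd n i})"
    unfolding independent_set_def using simple_graph_edgeD[OF graph] by blast
  then show ?thesis by (simp add: delta_def)
qed

lemma Re_sum_gt_1:
  assumes "finite S" "S \<noteq> {}" "\<And>i. i \<in> S \<Longrightarrow> Re (s i) > 1"
  shows "Re (\<Sum>i\<in>S. s i) > 1"
proof -
  obtain i where "i \<in> S" using assms(2) by blast
  then have "1 < Re (s i)" by (rule assms(3))
  also have "Re (s i) \<le> (\<Sum>i\<in>S. Re (s i))"
    using \<open>i \<in> S\<close> assms(1,3) by (intro member_le_sum)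
      (auto intro: less_imp_le less_trans[OF zero_less_one])
  finally show ?thesis by simp
qed

lemma has_sum_delta_series:
  assumes graph: "simple_graph k E" and cover: "vertex_cover k E J"
    and Re_gt_1: "\<And>i. i \<in> {1..k} \<Longrightarrow> Re (s i) > 1"
  shows "((\<lambda>n. delta E n / (\<Prod>i=1..k. of_nat (n i) powr s i)) has_sum
    (\<Prod>i=1..k. zeta (s i)) * D' E J s) (PiE {1..k} (\<lambda>_. {1..}))"
proof -
  have "Re (\<Sum>i\<in>S. s i) > 1" if "S \<subseteq> non_isolated k E" "2 \<le> card S" for S
    using that finite_subset[OF that(1) finite_non_isolated] Re_gt_1
    by (intro Re_sum_gt_1) (auto simp: non_isolated_def)
  then have "abs_convergent_euler_prod (cover_factor E J s)"
    by (rule abs_convergent_euler_prod_cover_factor[OF graph cover])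
  then have "((\<lambda>n. of_bool (\<forall>p. prime p \<longrightarrow> independent_set E {i \<in> {1..k}. p dvd n i}) *
        (\<Prod>i=1..k. 1 / of_nat (n i) powr s i)) has_sum
      (\<Prod>i=1..k. zeta (s i)) * euler_prod (cover_factor E J s)) (PiE {1..k} (\<lambda>_. {1..}))"
    unfolding cover_factor_eq_sum_bernoulli_weight[OF graph cover] using Re_gt_1
    by (intro has_sum_prime_local_condition completely_multiplicative_one_over_powr zeta_series)
      (auto simp: independent_set_def)
  then show ?thesis
    by (simp add: delta_eq_prime_local_condition[OF graph] D'_def prod_dividef)
qed

theorem theorem5:
  fixes k :: nat and E :: "nat set set" and J :: "nat set"
  assumes "k \<ge> 2"
    and "simple_graph k E"
    and "vertex_cover k E J"
  shows "\<exists>c :: nat set \<Rightarrow> int.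
    (\<forall>s :: nat \<Rightarrow> complex. (\<forall>i\<in>{1..k}. Re (s i) > 1) \<longrightarrow>
       ((\<lambda>n. delta E n / (\<Prod>i=1..k. of_nat (n i) powr s i)) has_sum
          (\<Prod>i=1..k. zeta (s i)) * D' E J s) (PiE {1..k} (\<lambda>_. {1..}))) \<and>
    (\<forall>s :: nat \<Rightarrow> complex. D' E J s = euler_prod (expanded_factor k E c s)) \<and>
    (\<forall>s :: nat \<Rightarrow> complex.
       (\<forall>S. S \<subseteq> non_isolated k E \<and> 2 \<le> card S \<and> card S \<le> card (non_isolated k E) \<longrightarrow>
          Re (\<Sum>i\<in>S. s i) > 1) \<longrightarrow>
       abs_convergent_euler_prod (cover_factor E J s) \<and>
       abs_convergent_euler_prod (expanded_factor k E c s))"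
proof (intro exI[of _ "indep_coeff E"] conjI allI impI)
  fix s :: "nat \<Rightarrow> complex"
  have factor_eq: "cover_factor E J s p = expanded_factor k E (indep_coeff E) s p"
    if "prime p" for p
    using cover_factor_eq_expanded_factor[OF assms(2,3)] prime_gt_0_nat[OF that] .
  show "((\<lambda>n. delta E n / (\<Prod>i=1..k. of_nat (n i) powr s i)) has_sum
      (\<Prod>i=1..k. zeta (s i)) * D' E J s) (PiE {1..k} (\<lambda>_. {1..}))" if "\<forall>i\<in>{1..k}. Re (s i) > 1"
    using that by (intro has_sum_delta_series assms) auto
  show "D' E J s = euler_prod (expanded_factor k E (indep_coeff E) s)"
    unfolding D'_def by (rule euler_prod_cong[OF factor_eq])
  assume "\<forall>S. S \<subseteq> non_isolated k E \<and> 2 \<le> card S \<and> card S \<le> card (non_isolated k E) \<longrightarrow>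
      Re (\<Sum>i\<in>S. s i) > 1"
  then show "abs_convergent_euler_prod (cover_factor E J s)"
    by (intro abs_convergent_euler_prod_cover_factor[OF assms(2,3)])
      (simp add: card_mono finite_non_isolated)
  then show "abs_convergent_euler_prod (expanded_factor k E (indep_coeff E) s)"
    by (simp only: abs_convergent_euler_prod_cong[OF factor_eq])
qed

end
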